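(* Let $a\in\mathbb{R}$, $\alpha\in(0,1]$, $x_a\in\mathbb{R}$, and let $F:[a,\infty)\times\mathbb{R}\to\mathbb{R}$ be continuous. For a function $x:[a,\infty)\to\mathbb{R}$ the following are equivalent: (1) $x$ is $\alpha$-differentiable at every $t\in(a,\infty)$, satisfies $T^{\alpha}_a x(t)=F(t,x(t))$ for every $t\in(a,\infty)$, and satisfies $x(a)=x_a$; (2) $x$ is continuously differentiable on $(a,\infty)$, satisfies $x'(t)=(t-a)^{\alpha-1}F(t,x(t))$ for every $t\in(a,\infty)$, and satisfies $x(a)=x_a$.
   Context: For $a\in\mathbb{R}$, $\alpha\in(0,1]$, a function $x:[a,\infty)\to\mathbb{R}$ and a point $t\in(a,\infty)$, the (left-sided) conformable derivative of order $\alpha$ of $x$ at $t$ with lower terminal $a$ is $$T^{\alpha}_a x(t)=\lim_{\theta\to 0}\frac{x\big(t+\theta(t-a)^{1-\alpha}\big)-x(t)}{\theta},$$ provided this (finite, two-sided) limit exists; $x$ is then called $\alpha$-differentiable at $t$. *)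

theory Defs
  imports "HOL-Analysis.Analysis"
begin

text \<open>
  A function on \<open>[a, \<infinity>)\<close> is represented by a total function on the reals. For \<open>t > a\<close> the
  limit below only sees arguments greater than \<open>a\<close> once \<open>\<theta>\<close> is small, so values to the left
  of \<open>a\<close> are irrelevant. The notions are meant for \<open>t > a\<close> only.
\<close>

definition has_conformable_derivative ::
    "real \<Rightarrow> real \<Rightarrow> (real \<Rightarrow> real) \<Rightarrow> real \<Rightarrow> real \<Rightarrow> bool" where
  "has_conformable_derivative a \<alpha> x D t \<longleftrightarrow>
     ((\<lambda>\<theta>. (x (t + \<theta> * (t - a) powr (1 - \<alpha>)) - x t) / \<theta>) \<longlongrightarrow> D) (at 0)"

definition conformable_differentiable ::
    "real \<Rightarrow> real \<Rightarrow> (real \<Rightarrow> real) \<Rightarrow> real \<Rightarrow> bool" where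
  "conformable_differentiable a \<alpha> x t \<longleftrightarrow> (\<exists>D. has_conformable_derivative a \<alpha> x D t)"

definition conformable_deriv ::
    "real \<Rightarrow> real \<Rightarrow> (real \<Rightarrow> real) \<Rightarrow> real \<Rightarrow> real" where
  "conformable_deriv a \<alpha> x t = (THE D. has_conformable_derivative a \<alpha> x D t)"

end

theory Submission
  imports Defs
begin

text \<open>
  At a fixed \<open>t > a\<close> the factor \<open>c = (t - a)\<^sup>1\<^sup>-\<^sup>\<alpha>\<close> is a nonzero constant, so the conformable
  difference quotient is the ordinary difference quotient at \<open>0\<close> of \<open>\<theta> \<mapsto> x (t + \<theta> c)\<close>. By the
  chain rule, applied to this affine reparametrisation and to its inverse, the conformable
  derivative exists iff \<open>x' t\<close> does, and it equals \<open>c x' t\<close>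
  (\<open>has_conformable_derivative_iff\<close>). Hence the two differential equations agree pointwise.

  Only the continuity of \<open>x'\<close> in (2) needs a further argument: a solution of (1) is
  differentiable, hence continuous on \<open>(a, \<infinity>)\<close>, so the right-hand side
  \<open>(t - a)\<^sup>\<alpha>\<^sup>-\<^sup>1 F (t, x t)\<close>, which is \<open>x' t\<close>, is continuous there.
\<close>

text \<open>
  Both directions are the chain rule: \<open>\<theta> \<mapsto> t + \<theta> c\<close> sends \<open>0\<close> to \<open>t\<close>, and since \<open>c \<noteq> 0\<close> it has
  the affine inverse \<open>s \<mapsto> (s - t) / c\<close>, so differentiability transfers back as well.
\<close>

lemma difference_quotient_scaled_iff:
  fixes f :: "'a :: real_normed_field \<Rightarrow> 'a"
  assumes "c \<noteq> 0"
  shows "((\<lambda>\<theta>. (f (t + \<theta> * c) - f t) / \<theta>) \<longlongrightarrow> D) (at 0)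
     \<longleftrightarrow> (f has_field_derivative D / c) (at t)"
proof -
  define g where "g = (\<lambda>\<theta>. f (t + \<theta> * c))"
  have "((\<lambda>\<theta>. (f (t + \<theta> * c) - f t) / \<theta>) \<longlongrightarrow> D) (at 0)
      \<longleftrightarrow> (g has_field_derivative D) (at 0)"
    by (simp add: DERIV_def g_def)
  also have "\<dots> \<longleftrightarrow> (f has_field_derivative D / c) (at t)"
  proof
    assume g: "(g has_field_derivative D) (at 0)"
    have h: "((\<lambda>s. (s - t) / c) has_field_derivative 1 / c) (at t)"
      using assms by (auto intro!: derivative_eq_intros)
    have "((\<lambda>s. g ((s - t) / c)) has_field_derivative D * (1 / c)) (at t)"
      by (rule DERIV_chain2[OF _ h]) (use g in simp)
    moreover have "(\<lambda>s. g ((s - t) / c)) = f"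
      using assms by (simp add: g_def)
    ultimately show "(f has_field_derivative D / c) (at t)"
      by simp
  next
    assume f: "(f has_field_derivative D / c) (at t)"
    have h: "((\<lambda>\<theta>. t + \<theta> * c) has_field_derivative c) (at 0)"
      by (auto intro!: derivative_eq_intros)
    have "((\<lambda>\<theta>. f (t + \<theta> * c)) has_field_derivative D / c * c) (at 0)"
      by (rule DERIV_chain2[OF _ h]) (use f in simp)
    then show "(g has_field_derivative D) (at 0)"
      using assms by (simp add: g_def)
  qed
  finally show ?thesis .
qed

lemma has_conformable_derivative_iff:
  assumes "a < t"
  shows "has_conformable_derivative a \<alpha> x D t
     \<longleftrightarrow> (x has_real_derivative (t - a) powr (\<alpha> - 1) * D) (at t)"
proof -
  have "D / (t - a) powr (1 - \<alpha>) = (t - a) powr (\<alpha> - 1) * D"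
    using powr_minus_divide[of "t - a" "1 - \<alpha>"] by simp
  then show ?thesis
    using assms difference_quotient_scaled_iff[of "(t - a) powr (1 - \<alpha>)" x t D]
    by (simp add: has_conformable_derivative_def)
qed

lemma conformable_deriv_eqI:
  assumes "has_conformable_derivative a \<alpha> x D t"
  shows "conformable_deriv a \<alpha> x t = D"
  using assms unfolding conformable_deriv_def has_conformable_derivative_def
  by (blast intro: the_equality tendsto_unique[OF at_neq_bot])

lemma conformable_equation_iff:
  "conformable_differentiable a \<alpha> x t \<and> conformable_deriv a \<alpha> x t = D
     \<longleftrightarrow> has_conformable_derivative a \<alpha> x D t"
  unfolding conformable_differentiable_def by (blast dest: conformable_deriv_eqI)

text \<open>
  The premise is an implication because \<open>G\<close> stands for a right-hand side that itself involves
  \<open>x\<close>: its continuity is available only after the equation has made \<open>x\<close> continuous, and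
  it is what upgrades differentiability to continuous differentiability.
\<close>

lemma C1_differentiable_on_equation_iff:
  fixes x :: "real \<Rightarrow> real"
  assumes "continuous_on S x \<Longrightarrow> continuous_on S G"
  shows "x C1_differentiable_on S \<and> (\<forall>t\<in>S. deriv x t = G t)
     \<longleftrightarrow> (\<forall>t\<in>S. (x has_real_derivative G t) (at t))"
proof
  assume "x C1_differentiable_on S \<and> (\<forall>t\<in>S. deriv x t = G t)"
  then show "\<forall>t\<in>S. (x has_real_derivative G t) (at t)"
    unfolding C1_differentiable_on_def has_real_derivative_iff_has_vector_derivative[symmetric]
    by (metis DERIV_imp_deriv)
next
  assume x: "\<forall>t\<in>S. (x has_real_derivative G t) (at t)"
  then have "continuous_on S x"
    by (blast intro: DERIV_continuous_on has_field_derivative_at_within)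
  then have "continuous_on S G"
    by (rule assms)
  with x show "x C1_differentiable_on S \<and> (\<forall>t\<in>S. deriv x t = G t)"
    unfolding C1_differentiable_on_def has_real_derivative_iff_has_vector_derivative[symmetric]
    by (blast intro: DERIV_imp_deriv)
qed

theorem mainTheorem4:
  fixes a \<alpha> x\<^sub>a :: real and F :: "real \<times> real \<Rightarrow> real" and x :: "real \<Rightarrow> real"
  assumes "0 < \<alpha>" and "\<alpha> \<le> 1"
    and "continuous_on ({a..} \<times> UNIV) F"
  shows "((\<forall>t\<in>{a<..}. conformable_differentiable a \<alpha> x t)
           \<and> (\<forall>t\<in>{a<..}. conformable_deriv a \<alpha> x t = F (t, x t))
           \<and> x a = x\<^sub>a)
     \<longleftrightarrow> (x C1_differentiable_on {a<..}
           \<and> (\<forall>t\<in>{a<..}. deriv x t = (t - a) powr (\<alpha> - 1) * F (t, x t))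
           \<and> x a = x\<^sub>a)"
proof -
  let ?G = "\<lambda>t. (t - a) powr (\<alpha> - 1) * F (t, x t)"
  have "continuous_on {a<..} ?G" if "continuous_on {a<..} x"
  proof -
    have "continuous_on {a<..} (\<lambda>t. F (t, x t))"
      by (rule continuous_on_compose2[OF assms(3)]) (use that in \<open>auto intro!: continuous_intros\<close>)
    then show ?thesis
      by (auto intro!: continuous_intros)
  qed
  then have "x C1_differentiable_on {a<..} \<and> (\<forall>t\<in>{a<..}. deriv x t = ?G t)
      \<longleftrightarrow> (\<forall>t\<in>{a<..}. (x has_real_derivative ?G t) (at t))"
    by (rule C1_differentiable_on_equation_iff)
  also have "\<dots> \<longleftrightarrow> (\<forall>t\<in>{a<..}. has_conformable_derivative a \<alpha> x (F (t, x t)) t)"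
    by (simp add: has_conformable_derivative_iff)
  also have "\<dots> \<longleftrightarrow> (\<forall>t\<in>{a<..}. conformable_differentiable a \<alpha> x t)
      \<and> (\<forall>t\<in>{a<..}. conformable_deriv a \<alpha> x t = F (t, x t))"
    unfolding conformable_equation_iff[symmetric] by blast
  finally show ?thesis
    by blast
qed

end
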